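(* (Synopsis Score Upper Bound Pruning) Given a synopsis entry $M_i$ and a user relationship score threshold $\sigma$, the entry $M_i$ can be safely pruned if it holds that $M_i.ub\_score_r<\sigma$.
   Context: A bipartite graph $G$ has two disjoint vertex sets $U(G)$ (users) and $L(G)$ (items) and a set $E(G)$ of edges $e_{u,v}$ with $u\in U(G)$, $v\in L(G)$. Each item $v$ has a keyword set $v.K$, and each edge $e_{u,v}$ has a weight $w_{u,v}$ (the frequency of interaction between $u$ and $v$). Subgraphs inherit weights and keyword sets. $G_t$ is a bipartite graph of this kind (the snapshot at time $t$ of a streaming bipartite network). A wedge $\angle(u_i,v,u_j)$ is a path $u_i - v - u_j$ with $u_i,u_j$ users and $v$ an item; its weight is $\min\{w_{u_i,v},w_{u_j,v}\}$. A butterfly $\Join(u_i,u_j,v_a,v_b)$, with two users $u_i,u_j$ and two items $v_a,v_b$, is a complete bipartite subgraph containing the wedges $\angle(u_i,v_a,u_j)$ and $\angle(u_i,v_b,u_j)$; its score is the product of the weights of these two wedges. The support $sup(e)$ of an edge $e$ in a subgraph is the number of butterflies of that subgraph containing $e$. The user relationship score $score_{u_i,u_j}(g)$ is the sum of the scores of all butterflies of $g$ containing both $u_i$ and $u_j$ (each pair $\{v_a,v_b\}$ counted once). Given a center user $u_c\in U(G_t)$, a threshold $k$ of butterfly number, a maximum radius $r$ and a score threshold $\sigma$, a $(k,r,\sigma)$-bitruss is a connected subgraph $h$ of $G_t$ with $u_c\in h$ such that: (Support) every edge of $h$ has support at least $k$; (Radius) every user $u_i\in U(h)$ satisfies $dist(u_c,u_i)\le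 2r$, where $dist$ is the shortest-path distance in $h$; (Score) for any two users $u_i,u_j$ in a wedge $\angle(u_i,v,u_j)$ of $h$, $score_{u_i,u_j}(h)\ge\sigma$. Given in addition a set $Q$ of query keywords, the CD-SBN problem (community detection over a streaming bipartite network) asks for the subgraphs of $G_t$ that are $(k,r,\sigma)$-bitrusses and all of whose items $v$ satisfy $v.K\cap Q\neq\emptyset$; these are the CD-SBN answers. For a user $u$, $hop(u,2r)$ is the $(2r)$-hop subgraph of $G_t$ centered at $u$ (extracted by breadth-first search from $u$ to radius $2r$), and $u.ub\_score_r=\max_{u_i,u_j\in hop(u,2r)}score_{u_i,u_j}(G_t)$, the maximum being over all user pairs $(u_i,u_j)$ in $hop(u,2r)$. The synopsis is a tree built over the user vertices of $G_t$; each entry $M_i$ of a node corresponds to a group of users (the users "under" $M_i$), and $M_i.ub\_score_r=\max_{u\in M_i}u.ub\_score_r$. "Can be safely pruned" means that $M_i$ can be discarded from the search for CD-SBN answers because it cannot contain any vertices in the CD-SBN answer.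
   Formalization: Only CD-SBN answers with at least two users are considered: a center user alone (or, for k = 0, a star around it) meets all conditions of a (k,r,σ)-bitruss vacuously and would make the claim false. *)

theory Defs
  imports Complex_Main "HOL-Library.Extended_Nat"
begin

text \<open>Users and items have different types, so the two sides of a graph are always disjoint.
  The values of \<open>keyword_set\<close> outside \<open>items\<close> and of \<open>weight\<close> outside \<open>edges\<close> are irrelevant.\<close>

record ('u, 'v, 'k) bigraph =
  users :: "'u set"
  items :: "'v set"
  edges :: "('u \<times> 'v) set"
  keyword_set :: "'v \<Rightarrow> 'k set"
  weight :: "'u \<Rightarrow> 'v \<Rightarrow> real"

definition wf_bigraph :: "('u, 'v, 'k) bigraph \<Rightarrow> bool" where
  "wf_bigraph g \<longleftrightarrow>
     finite (users g) \<and> finite (items g) \<and> edges g \<subseteq> users g \<times> items g \<and>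
     (\<forall>(u, v) \<in> edges g. 0 \<le> weight g u v)"

definition subgraph :: "('u, 'v, 'k) bigraph \<Rightarrow> ('u, 'v, 'k) bigraph \<Rightarrow> bool" where
  "subgraph h g \<longleftrightarrow>
     wf_bigraph h \<and> users h \<subseteq> users g \<and> items h \<subseteq> items g \<and> edges h \<subseteq> edges g \<and>
     (\<forall>v \<in> items h. keyword_set h v = keyword_set g v) \<and>
     (\<forall>(u, v) \<in> edges h. weight h u v = weight g u v)"

definition vertices :: "('u, 'v, 'k) bigraph \<Rightarrow> ('u + 'v) set" where
  "vertices g = Inl ` users g \<union> Inr ` items g"

definition adj :: "('u, 'v, 'k) bigraph \<Rightarrow> (('u + 'v) \<times> ('u + 'v)) set" where
  "adj g = (\<Union>(u, v) \<in> edges g. {(Inl u, Inr v), (Inr v, Inl u)})"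

definition connected_bigraph :: "('u, 'v, 'k) bigraph \<Rightarrow> bool" where
  "connected_bigraph g \<longleftrightarrow> (\<forall>x \<in> vertices g. \<forall>y \<in> vertices g. (x, y) \<in> (adj g)\<^sup>*)"

text \<open>Shortest-path distance; it is \<open>\<infinity>\<close> between vertices that are not joined by a path.\<close>

definition gdist :: "('u, 'v, 'k) bigraph \<Rightarrow> 'u + 'v \<Rightarrow> 'u + 'v \<Rightarrow> enat" where
  "gdist g x y = (INF n \<in> {n. (x, y) \<in> adj g ^^ n}. enat n)"

definition wedge :: "('u, 'v, 'k) bigraph \<Rightarrow> 'u \<Rightarrow> 'v \<Rightarrow> 'u \<Rightarrow> bool" where
  "wedge g ui v uj \<longleftrightarrow> ui \<noteq> uj \<and> (ui, v) \<in> edges g \<and> (uj, v) \<in> edges g"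

text \<open>A butterfly is encoded by its unordered pair of users and its unordered pair of items,
  so that each butterfly is counted once.\<close>

definition butterflies :: "('u, 'v, 'k) bigraph \<Rightarrow> ('u set \<times> 'v set) set" where
  "butterflies g =
     {({ui, uj}, {va, vb}) | ui uj va vb. va \<noteq> vb \<and> wedge g ui va uj \<and> wedge g ui vb uj}"

definition wedge_weight :: "('u, 'v, 'k) bigraph \<Rightarrow> 'u set \<Rightarrow> 'v \<Rightarrow> real" where
  "wedge_weight g A v = Min ((\<lambda>u. weight g u v) ` A)"

definition butterfly_score :: "('u, 'v, 'k) bigraph \<Rightarrow> 'u set \<times> 'v set \<Rightarrow> real" where
  "butterfly_score g b = (\<Prod>v \<in> snd b. wedge_weight g (fst b) v)"

definition edge_support :: "('u, 'v, 'k) bigraph \<Rightarrow> 'u \<times> 'v \<Rightarrow> nat" where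
  "edge_support g e = card {b \<in> butterflies g. fst e \<in> fst b \<and> snd e \<in> snd b}"

definition user_score :: "('u, 'v, 'k) bigraph \<Rightarrow> 'u \<Rightarrow> 'u \<Rightarrow> real" where
  "user_score g ui uj =
     (\<Sum>b \<in> {b \<in> butterflies g. ui \<in> fst b \<and> uj \<in> fst b}. butterfly_score g b)"

definition bitruss ::
  "('u, 'v, 'k) bigraph \<Rightarrow> 'u \<Rightarrow> nat \<Rightarrow> nat \<Rightarrow> real \<Rightarrow> ('u, 'v, 'k) bigraph \<Rightarrow> bool" where
  "bitruss G uc k r \<sigma> h \<longleftrightarrow>
     subgraph h G \<and> connected_bigraph h \<and> uc \<in> users h \<and>
     (\<forall>e \<in> edges h. k \<le> edge_support h e) \<and>
     (\<forall>u \<in> users h. gdist h (Inl uc) (Inl u) \<le> enat (2 * r)) \<and>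
     (\<forall>ui v uj. wedge h ui v uj \<longrightarrow> \<sigma> \<le> user_score h ui uj)"

definition cd_sbn_answer ::
  "('u, 'v, 'k) bigraph \<Rightarrow> 'u \<Rightarrow> nat \<Rightarrow> nat \<Rightarrow> real \<Rightarrow> 'k set \<Rightarrow> ('u, 'v, 'k) bigraph \<Rightarrow> bool" where
  "cd_sbn_answer G uc k r \<sigma> Q h \<longleftrightarrow>
     bitruss G uc k r \<sigma> h \<and> (\<forall>v \<in> items h. keyword_set h v \<inter> Q \<noteq> {})"

definition hop :: "('u, 'v, 'k) bigraph \<Rightarrow> 'u \<Rightarrow> nat \<Rightarrow> ('u, 'v, 'k) bigraph" where
  "hop G u d =
     (let U = {u' \<in> users G. gdist G (Inl u) (Inl u') \<le> enat d};
          L = {v \<in> items G. gdist G (Inl u) (Inr v) \<le> enat d}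
      in G\<lparr>users := U, items := L, edges := edges G \<inter> U \<times> L\<rparr>)"

text \<open>Scores are nonnegative, so the inserted \<open>0\<close> only matters when the hop subgraph has a
  single user and there is no pair to maximise over.\<close>

definition ub_score :: "('u, 'v, 'k) bigraph \<Rightarrow> nat \<Rightarrow> 'u \<Rightarrow> real" where
  "ub_score G r u =
     Max (insert 0 {user_score G ui uj | ui uj.
       ui \<in> users (hop G u (2 * r)) \<and> uj \<in> users (hop G u (2 * r)) \<and> ui \<noteq> uj})"

text \<open>A tree node is the list of its entries. An entry is a single user (in a leaf node) or
  points to a child node.\<close>

datatype (users_under: 'u) entry = User 'u | Child "'u entry list"

type_synonym 'u synopsis = "'u entry list"

inductive_set synopsis_entries :: "'u synopsis \<Rightarrow> 'u entry set" for S where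
  root: "M \<in> set S \<Longrightarrow> M \<in> synopsis_entries S"
| child: "Child Ms \<in> synopsis_entries S \<Longrightarrow> M \<in> set Ms \<Longrightarrow> M \<in> synopsis_entries S"

definition synopsis_over :: "('u, 'v, 'k) bigraph \<Rightarrow> 'u synopsis \<Rightarrow> bool" where
  "synopsis_over G S \<longleftrightarrow> (\<Union>M \<in> set S. users_under M) = users G"

definition entry_ub_score :: "('u, 'v, 'k) bigraph \<Rightarrow> nat \<Rightarrow> 'u entry \<Rightarrow> real" where
  "entry_ub_score G r M = Max (ub_score G r ` users_under M)"

text \<open>The isolated center user satisfies every condition of \<open>bitruss\<close> vacuously, whatever \<open>k\<close>
  and \<open>\<sigma>\<close> are, and for \<open>k = 0\<close> so can a star around it: a graph with a single user has no
  wedge, hence no relationship score. Statements about communities therefore ask for at least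
  two users. For positive \<open>k\<close> this only excludes edgeless graphs.\<close>

lemma two_users_if_bitruss_has_edge:
  assumes "bitruss G uc k r \<sigma> h" and "1 \<le> k" and "edges h \<noteq> {}"
  shows "2 \<le> card (users h)"
proof -
  obtain e where e: "e \<in> edges h" using assms(3) by blast
  with assms have "edge_support h e \<noteq> 0" by (force simp: bitruss_def)
  then have "butterflies h \<noteq> {}" by (auto simp: edge_support_def)
  then obtain ui uj va where w: "wedge h ui va uj" by (auto simp: butterflies_def)
  have h: "finite (users h)" "edges h \<subseteq> users h \<times> items h"
    using assms(1) by (auto simp: bitruss_def subgraph_def wf_bigraph_def)
  with w have "{ui, uj} \<subseteq> users h" "ui \<noteq> uj" by (auto simp: wedge_def)
  then show ?thesis using card_mono[OF h(1), of "{ui, uj}"] by simp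
qed

end

(* A connected community with at least two users has, at each of its users u, a wedge (u, v, u').
   The score of the pair (u, u') in the community is at least sigma, and since a subgraph has fewer
   butterflies, each with the same nonnegative score, it is at least sigma in G as well.
   Two users force r > 0 by the radius condition, so u' lies in hop(u, 2r) and ub_score at u is at
   least sigma. *)

theory Submission
  imports Defs
begin

lemma gdist_le:
  assumes "(x, y) \<in> adj g ^^ n"
  shows "gdist g x y \<le> enat n"
  using assms by (auto simp: gdist_def intro: INF_lower)

lemma gdist_eq_0_imp_eq:
  assumes "gdist g x y = 0"
  shows "x = y"
proof -
  \<comment> \<open>Phrased as a strict bound, so that the infimum yields an actual walk of length
    below 1, that is, of length 0.\<close>
  have "gdist g x y < enat 1"
    using assms by (simp add: zero_enat_def)
  then obtain n where "(x, y) \<in> adj g ^^ n" "n < 1"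
    by (auto simp: gdist_def INF_less_iff)
  then show ?thesis by simp
qed

lemma gdist_le_2_if_wedge:
  assumes "wedge g u v u'"
  shows "gdist g (Inl u) (Inl u') \<le> enat 2"
proof (rule gdist_le)
  have "(Inl u, Inr v) \<in> adj g" "(Inr v, Inl u') \<in> adj g"
    using assms by (force simp: adj_def wedge_def)+
  then show "(Inl u, Inl u') \<in> adj g ^^ 2"
    by (auto simp: numeral_2_eq_2)
qed

text \<open>A walk from \<open>u\<close> can only get past the items adjacent to \<open>u\<close> by
  stepping from such an item to another user, and this step completes a wedge at
  \<open>u\<close>.\<close>

lemma reachable_user_imp_wedge:
  assumes "(Inl u, Inl w) \<in> (adj g)\<^sup>*" and "w \<noteq> u"
  shows "\<exists>v u'. wedge g u v u'"
proof -
  \<comment> \<open>The invariant ranges over all vertices \<open>y\<close>, since the walk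
    alternates between users and items: without a wedge at \<open>u\<close>, it stays within
    \<open>u\<close> and its adjacent items.\<close>
  have "(\<exists>v u'. wedge g u v u') \<or> y = Inl u \<or> (\<exists>v. y = Inr v \<and> (u, v) \<in> edges g)"
    if "(Inl u, y) \<in> (adj g)\<^sup>*" for y
    using that
  proof (induction rule: rtrancl_induct)
    case base
    then show ?case by simp
  next
    case (step y z)
    then show ?case by (auto simp: adj_def wedge_def)
  qed
  then show ?thesis using assms by blast
qed

lemma wedge_in_connected:
  assumes "connected_bigraph g" and "u \<in> users g" and "2 \<le> card (users g)"
  shows "\<exists>v u'. wedge g u v u'"
proof -
  have "\<not> users g \<subseteq> {u}"
    using assms(3) card_mono[of "{u}" "users g"] by auto
  then obtain w where "w \<in> users g" "w \<noteq> u" by blast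
  with assms(1,2) show ?thesis
    by (auto simp: connected_bigraph_def vertices_def intro: reachable_user_imp_wedge)
qed

lemma wedge_subgraph: "subgraph h g \<Longrightarrow> wedge h ui v uj \<Longrightarrow> wedge g ui v uj"
  by (auto simp: subgraph_def wedge_def)

lemma butterflies_subgraph: "subgraph h g \<Longrightarrow> butterflies h \<subseteq> butterflies g"
  by (force simp: butterflies_def intro: wedge_subgraph)

lemma finite_butterflies:
  assumes "wf_bigraph g"
  shows "finite (butterflies g)"
proof (rule finite_subset)
  show "butterflies g \<subseteq> Pow (users g) \<times> Pow (items g)"
    using assms by (auto simp: butterflies_def wedge_def wf_bigraph_def)
  show "finite (Pow (users g) \<times> Pow (items g))"
    using assms by (simp add: wf_bigraph_def)
qed

lemma wedge_weight_nonneg: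
  assumes "wf_bigraph g" and "wedge g ui v uj"
  shows "0 \<le> wedge_weight g {ui, uj} v"
  using assms by (fastforce simp: wf_bigraph_def wedge_def wedge_weight_def)

text \<open>The weights of \<open>h\<close> and \<open>g\<close> are only known to agree on edges of
  \<open>h\<close>; the wedge ensures that both values in the minimum belong to such edges.\<close>

lemma wedge_weight_subgraph:
  assumes "subgraph h g" and "wedge h ui v uj"
  shows "wedge_weight h {ui, uj} v = wedge_weight g {ui, uj} v"
proof -
  have "weight h ui v = weight g ui v" "weight h uj v = weight g uj v"
    using assms by (auto simp: subgraph_def wedge_def)
  then show ?thesis by (simp add: wedge_weight_def)
qed

lemma butterfly_score_nonneg:
  assumes "wf_bigraph g" and "b \<in> butterflies g"
  shows "0 \<le> butterfly_score g b"
  using assms by (auto simp: butterflies_def butterfly_score_def wedge_weight_nonneg)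

lemma butterfly_score_subgraph:
  assumes "subgraph h g" and "b \<in> butterflies h"
  shows "butterfly_score h b = butterfly_score g b"
  using assms by (auto simp: butterflies_def butterfly_score_def wedge_weight_subgraph)

lemma user_score_subgraph_le:
  assumes "wf_bigraph g" and "subgraph h g"
  shows "user_score h ui uj \<le> user_score g ui uj"
proof -
  have "user_score h ui uj
      = (\<Sum>b \<in> {b \<in> butterflies h. ui \<in> fst b \<and> uj \<in> fst b}. butterfly_score g b)"
    unfolding user_score_def
    by (rule sum.cong) (auto simp: butterfly_score_subgraph[OF assms(2)])
  also have "\<dots> \<le> user_score g ui uj"
    unfolding user_score_def
    \<comment> \<open>The extra summands are nonnegative. Finiteness matters as well, because a sum
      over an infinite set is 0 by default.\<close>
    using butterflies_subgraph[OF assms(2)] finite_butterflies[OF assms(1)]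
      butterfly_score_nonneg[OF assms(1)]
    by (intro sum_mono2) auto
  finally show ?thesis .
qed

lemma user_score_le_ub_score:
  assumes "wf_bigraph G" and "ui \<in> users (hop G u (2 * r))" and "uj \<in> users (hop G u (2 * r))"
    and "ui \<noteq> uj"
  shows "user_score G ui uj \<le> ub_score G r u"
  unfolding ub_score_def
proof (rule Max_ge)
  let ?H = "users (hop G u (2 * r))"
  have "finite ?H"
    using assms(1) by (simp add: hop_def Let_def wf_bigraph_def)
  \<comment> \<open>The set of scores in \<open>ub_score\<close> is part of this image; its
    finiteness makes \<open>Max\<close> an upper bound.\<close>
  then have "finite ((\<lambda>(a, b). user_score G a b) ` (?H \<times> ?H))"
    by blast
  then show "finite (insert 0 {user_score G ui uj | ui uj. ui \<in> ?H \<and> uj \<in> ?H \<and> ui \<noteq> uj})"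
    unfolding finite_insert by (rule finite_subset[rotated]) auto
qed (use assms in blast)

text \<open>The far user of a wedge is at distance at most 2 from \<open>u\<close>, which is within
  \<open>2 * r\<close> as soon as \<open>r\<close> is positive. For \<open>r = 0\<close> the hop
  subgraph has no user besides \<open>u\<close>.\<close>

lemma wedge_score_le_ub_score:
  assumes "wf_bigraph G" and "wedge G u v u'" and "0 < r"
  shows "user_score G u u' \<le> ub_score G r u"
proof (rule user_score_le_ub_score[OF assms(1)])
  have users: "u \<in> users G" "u' \<in> users G"
    using assms(1,2) by (auto simp: wf_bigraph_def wedge_def)
  have "gdist G (Inl u) (Inl u) \<le> enat 0"
    by (rule gdist_le) simp
  then show "u \<in> users (hop G u (2 * r))"
    using users by (simp add: hop_def Let_def zero_enat_def[symmetric])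
  have "gdist G (Inl u) (Inl u') \<le> enat (2 * r)"
    using gdist_le_2_if_wedge[OF assms(2)] by (rule order_trans) (use assms(3) in simp)
  then show "u' \<in> users (hop G u (2 * r))"
    using users by (simp add: hop_def Let_def)
  show "u \<noteq> u'"
    using assms(2) by (simp add: wedge_def)
qed

text \<open>Going down to a child entry can only shrink the set of users. The inclusion serves to
  bound \<open>users_under M\<close> by a finite set.\<close>

lemma users_under_synopsis_entry:
  assumes "synopsis_over G S" and "M \<in> synopsis_entries S"
  shows "users_under M \<subseteq> users G"
  using assms(2)
proof induction
  case (root M)
  then show ?case using assms(1) by (auto simp: synopsis_over_def)
next
  case (child Ms M)
  then show ?case by auto
qed

lemma bitruss_radius_pos:
  assumes "bitruss G uc k r \<sigma> h" and "2 \<le> card (users h)"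
  shows "0 < r"
proof (rule ccontr)
  assume "\<not> 0 < r"
  then have "\<forall>u \<in> users h. gdist h (Inl uc) (Inl u) = 0"
    using assms(1) by (simp add: bitruss_def zero_enat_def[symmetric])
  then have "users h \<subseteq> {uc}"
    by (auto dest: gdist_eq_0_imp_eq)
  then show False
    using assms(2) card_mono[of "{uc}" "users h"] by simp
qed

text \<open>The radius condition is centred at \<open>uc\<close> and the hop subgraph at
  \<open>u\<close>, so the former is used just to get \<open>0 < r\<close>; a wedge at
  \<open>u\<close> itself supplies the pair of users.\<close>

lemma bitruss_ub_score_ge:
  assumes "wf_bigraph G" and "bitruss G uc k r \<sigma> h" and "2 \<le> card (users h)" and "u \<in> users h"
  shows "\<sigma> \<le> ub_score G r u"
proof -
  have sub: "subgraph h G"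
    using assms(2) by (simp add: bitruss_def)
  obtain v u' where w: "wedge h u v u'"
    using wedge_in_connected assms(2-4) by (metis bitruss_def)
  have "\<sigma> \<le> user_score h u u'"
    using assms(2) w by (auto simp: bitruss_def)
  also have "\<dots> \<le> user_score G u u'"
    by (rule user_score_subgraph_le[OF assms(1) sub])
  also have "\<dots> \<le> ub_score G r u"
    \<comment> \<open>The wedge is moved to \<open>G\<close>, where the hop distances are
      measured.\<close>
    using assms(1) wedge_subgraph[OF sub w] bitruss_radius_pos[OF assms(2,3)]
    by (rule wedge_score_le_ub_score)
  finally show ?thesis .
qed

theorem lemma8:
  fixes G :: "('u, 'v, 'k) bigraph"
    and S :: "'u synopsis" and M :: "'u entry"
    and uc :: 'u and k r :: nat and \<sigma> :: real and Q :: "'k set"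
  assumes "wf_bigraph G"
    and "synopsis_over G S"
    and "M \<in> synopsis_entries S"
    and "entry_ub_score G r M < \<sigma>"
  shows "\<forall>h. cd_sbn_answer G uc k r \<sigma> Q h \<and> 2 \<le> card (users h)
              \<longrightarrow> users_under M \<inter> users h = {}"
proof (intro allI impI equals0I)
  fix h u
  assume h: "cd_sbn_answer G uc k r \<sigma> Q h \<and> 2 \<le> card (users h)"
    and u: "u \<in> users_under M \<inter> users h"
  \<comment> \<open>Needed for the \<open>Max\<close> in \<open>entry_ub_score\<close> to dominate
    the value at \<open>u\<close>.\<close>
  have "finite (users_under M)"
    using users_under_synopsis_entry[OF assms(2,3)] assms(1)
    by (auto simp: wf_bigraph_def intro: finite_subset)
  then have "ub_score G r u \<le> entry_ub_score G r M"
    using u by (simp add: entry_ub_score_def)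
  moreover have "\<sigma> \<le> ub_score G r u"
    using bitruss_ub_score_ge[OF assms(1)] h u by (auto simp: cd_sbn_answer_def)
  ultimately show False
    using assms(4) by simp
qed

end
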